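(* (Infinite partial fraction decomposition.) For $s,t,x,y\in\mathbb{C}$ with $\mathrm{Re}(s),\mathrm{Re}(t),\mathrm{Re}(x),\mathrm{Re}(y)>0$, we have $$\frac{1}{x^sy^t}=\sum_{k=0}^{\infty}\left[\binom{t+k-1}{k}\frac{1}{x^{s-k}(x+y)^{t+k}}-\binom{s+t+k-1}{s+k}\frac{1}{x^{-k}(x+y)^{s+t+k}}\right]+\sum_{k=0}^{\infty}\left[\binom{s+k-1}{k}\frac{1}{y^{t-k}(x+y)^{s+k}}-\binom{s+t+k-1}{t+k}\frac{1}{y^{-k}(x+y)^{s+t+k}}\right].$$
   Context: The generalized binomial coefficient is $\binom{s}{t}:=\dfrac{\Gamma(s+1)}{\Gamma(t+1)\Gamma(s-t+1)}$ for $s,t\in\mathbb{C}$, where $\Gamma$ is the gamma function. Complex powers of numbers with positive real part are taken with the principal branch.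
   Formalization: As stated, a series can diverge (s=t=2, x=1+10i, y=1-5i). Proved instead: the identity holds whenever both series converge; the first converges if |x|<|x+y|, the second if |y|<|x+y| (so both do for all positive real x, y). *)

theory Defs
  imports "HOL-Complex_Analysis.Complex_Analysis"
begin

text \<open>The binomial coefficient with two complex arguments; the library's \<^const>\<open>gbinomial\<close>
  only admits a natural number as lower argument. At a pole, \<^const>\<open>Gamma\<close> is 0 in the library,
  so a pole in the denominator gives the value 0, as it should.\<close>

definition cbinom :: "complex \<Rightarrow> complex \<Rightarrow> complex" where
  "cbinom s t = Gamma (s + 1) / (Gamma (t + 1) * Gamma (s - t + 1))"

text \<open>
  Convergence of the infinite partial fraction decomposition: put \<open>u = x / (x + y)\<close>. Both
  \<open>cbinom (t + k - 1) k\<close> and \<open>cbinom (s + t + k - 1) (s + k)\<close> are asymptotic to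
  \<open>k powr (t - 1) / Gamma t\<close>, so the term of index \<open>k\<close> of the first series behaves like
  \<open>k powr (t - 1) * u ^ k\<close> times the constant
  \<open>(x powr -s - (x + y) powr -s) / ((x + y) powr t * Gamma t)\<close>. For non-real \<open>x\<close> and \<open>y\<close> in
  the right half-plane \<open>\<bar>u\<bar> > 1\<close> is possible (\<open>x = 1 + 10 i\<close>, \<open>y = 1 - 5 i\<close>), and
  the series then diverges in general. Hence the theorem asserts the identity whenever both series
  converge, and convergence of each series in the disc where its ratio has modulus below 1, which
  includes all positive real \<open>x\<close> and \<open>y\<close>.
\<close>

end

theory Submission
  imports Defs
begin

text \<open>
  Put \<open>u = x / (x + y)\<close> and divide by \<open>(x + y) powr -(s + t)\<close>. For \<open>\<bar>u\<bar> < 1\<close> the first part of the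
  first series is a binomial series and equals \<open>u powr -s * (1 - u) powr -t\<close>, while its second part
  is the same quantity times the regularised incomplete beta function \<open>I(s, t; u)\<close>. The identity is
  therefore \<open>I(s, t; u) + I(t, s; 1 - u) = 1\<close>. Both functions are, up to sign and constants, the same
  primitive of \<open>z powr (s - 1) * (1 - z) powr (t - 1)\<close> on the plane without \<open>(-\<infinity>, 0]\<close> and
  \<open>[1, \<infinity>)\<close>; the constant is found by letting \<open>u\<close> tend to 1 along the reals. Abel's limit theorem
  covers \<open>\<bar>u\<bar> = 1\<close> and \<open>\<bar>1 - u\<bar> = 1\<close>. If \<open>\<bar>u\<bar> > 1\<close>, convergence of the first series forces
  \<open>t = 1\<close> and \<open>u powr s = 1\<close>; then the first series vanishes and the second one telescopes.
\<close>

subsection \<open>Abelian limits\<close>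

definition poch_coeff :: "'a::field_char_0 \<Rightarrow> nat \<Rightarrow> 'a" where
  "poch_coeff s k = pochhammer s k / fact k"

lemma poch_coeff_0 [simp]: "poch_coeff s 0 = 1"
  by (simp add: poch_coeff_def)

lemma poch_coeff_1 [simp]: "poch_coeff 1 k = 1"
  by (simp add: poch_coeff_def pochhammer_fact [symmetric])

lemma poch_coeff_Suc: "of_nat (Suc k) * poch_coeff s (Suc k) = (s + of_nat k) * poch_coeff s k"
  by (simp add: poch_coeff_def pochhammer_Suc field_simps del: of_nat_Suc)

lemma poch_coeff_eq_gbinomial: "poch_coeff s k * z ^ k = ((-s) gchoose k) * (-z) ^ k"
proof -
  have "(-1) ^ k * (-z) ^ k = z ^ k"
    by (simp add: power_mult_distrib [symmetric])
  then show ?thesis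
    by (simp add: poch_coeff_def gbinomial_pochhammer mult.assoc)
qed

lemma poch_coeff_sums_complex:
  assumes "norm (z::complex) < 1"
  shows "(\<lambda>k. poch_coeff s k * z ^ k) sums (1 - z) powr (-s)"
  using gen_binomial_complex [of "-z" "-s"] assms by (simp add: poch_coeff_eq_gbinomial)

lemma poch_coeff_sums_real:
  assumes "\<bar>r::real\<bar> < 1"
  shows "(\<lambda>k. poch_coeff s k * r ^ k) sums (1 - r) powr (-s)"
  using gen_binomial_real [of "-r" "-s"] assms by (simp add: poch_coeff_eq_gbinomial)

lemma poch_coeff_nonneg:
  assumes "(s::real) > 0"
  shows "poch_coeff s k \<ge> 0"
  using pochhammer_pos [OF assms, of k] by (simp add: poch_coeff_def)

lemma tendsto_one_minus_powr_at_left: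
  assumes "(\<sigma>::real) > 0"
  shows "((\<lambda>r. (1 - r) powr \<sigma>) \<longlongrightarrow> 0) (at_left 1)"
proof -
  have "((\<lambda>r::real. 1 - r) \<longlongrightarrow> 1 - 1) (at_left 1)"
    by (intro tendsto_intros)
  moreover have "eventually (\<lambda>r::real. 0 \<le> 1 - r) (at_left 1)"
    by (auto simp: eventually_at_filter)
  ultimately show ?thesis
    using assms by (intro tendsto_zero_powrI [of _ _ "\<lambda>_. \<sigma>" \<sigma>]) auto
qed

lemma eventually_at_left_1: "eventually (\<lambda>r::real. 0 < r \<and> r < 1) (at_left 1)"
  using eventually_at_left_real [of 0 "1::real"] by (auto elim!: eventually_mono)

text \<open>The case \<open>\<sigma> = 1\<close> yields Abel's limit theorem, the general case the behaviour of the
  incomplete beta function at 1.\<close>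

lemma abelian_weighted_mean_null:
  fixes d :: "nat \<Rightarrow> complex"
  assumes d: "d \<longlonglongrightarrow> 0" and s: "\<sigma> > 0"
  shows "((\<lambda>r. of_real ((1 - r) powr \<sigma>)
            * (\<Sum>k. of_real (poch_coeff \<sigma> k) * d k * of_real r ^ k)) \<longlongrightarrow> 0) (at_left 1)"
proof (rule tendstoI)
  fix e :: real assume e: "e > 0"
  let ?a = "poch_coeff \<sigma>"
  have a: "?a k \<ge> 0" for k using poch_coeff_nonneg [OF s] .
  from d e obtain N where N: "\<And>k. k \<ge> N \<Longrightarrow> norm (d k) \<le> e / 2"
    unfolding LIMSEQ_def by (metis half_gt_zero dist_0_norm dist_commute less_imp_le)
  define M where "M = (\<Sum>k<N. ?a k * norm (d k))"
  have "((\<lambda>r. e / 2 + M * (1 - r) powr \<sigma>) \<longlongrightarrow> e / 2 + M * 0) (at_left 1)"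
    by (intro tendsto_intros tendsto_one_minus_powr_at_left s)
  then have ev: "eventually (\<lambda>r. e / 2 + M * (1 - r) powr \<sigma> < e) (at_left 1)"
    using e by (auto dest!: order_tendstoD(2) [where a = e])
  show "eventually (\<lambda>r. dist (of_real ((1 - r) powr \<sigma>)
            * (\<Sum>k. of_real (?a k) * d k * of_real r ^ k)) 0 < e) (at_left 1)"
    using ev eventually_at_left_1
  proof eventually_elim
    case (elim r)
    then have r: "0 < r" "r < 1" by auto
    have sm: "(\<lambda>k. ?a k * r ^ k) sums (1 - r) powr (- \<sigma>)"
      using r by (intro poch_coeff_sums_real) auto
    have sm2: "(\<lambda>k. if k < N then ?a k * norm (d k) else 0) sums M"
      using sums_If_finite_set [of "{..<N}" "\<lambda>k. ?a k * norm (d k)"] by (simp add: M_def)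
    have sm3: "(\<lambda>k. e / 2 * (?a k * r ^ k) + (if k < N then ?a k * norm (d k) else 0))
        sums (e / 2 * (1 - r) powr (- \<sigma>) + M)"
      by (intro sums_add sums_mult sm sm2)
    have le: "norm (of_real (?a k) * d k * of_real r ^ k)
        \<le> e / 2 * (?a k * r ^ k) + (if k < N then ?a k * norm (d k) else 0)" for k
    proof (cases "k < N")
      case True
      have "?a k * norm (d k) * r ^ k \<le> ?a k * norm (d k) * 1"
        using r a by (intro mult_left_mono power_le_one) auto
      moreover have "0 \<le> e * (?a k * r ^ k)" using e r a by auto
      ultimately show ?thesis
        using True r a[of k] by (simp add: norm_mult norm_power)
    next
      case False
      then have "(?a k * r ^ k) * norm (d k) \<le> (?a k * r ^ k) * (e / 2)"
        using r a N by (intro mult_left_mono) auto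
      then show ?thesis
        using False r a[of k] by (simp add: norm_mult norm_power mult_ac)
    qed
    have "norm (\<Sum>k. of_real (?a k) * d k * of_real r ^ k) \<le> e / 2 * (1 - r) powr (- \<sigma>) + M"
      using norm_suminf_le [OF le sums_summable [OF sm3]] sums_unique [OF sm3] by simp
    then have "(1 - r) powr \<sigma> * norm (\<Sum>k. of_real (?a k) * d k * of_real r ^ k)
        \<le> (1 - r) powr \<sigma> * (e / 2 * (1 - r) powr (- \<sigma>) + M)"
      by (intro mult_left_mono) auto
    also have "\<dots> = e / 2 + M * (1 - r) powr \<sigma>"
      using r by (simp add: powr_minus field_simps)
    finally show ?case
      using elim by (simp add: norm_mult)
  qed
qed

theorem Abel_limit:
  fixes c :: "nat \<Rightarrow> complex"
  assumes c: "c sums S"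
  shows "((\<lambda>r. \<Sum>k. c k * of_real r ^ k) \<longlongrightarrow> S) (at_left 1)"
proof -
  define D where "D n = (\<Sum>k\<le>n. c k) - S" for n
  have D0: "D \<longlonglongrightarrow> 0"
    using c unfolding D_def sums_def_le by (auto intro!: tendsto_eq_intros)
  have "((\<lambda>r. of_real ((1 - r) powr 1) * (\<Sum>k. of_real (poch_coeff 1 k) * D k * of_real r ^ k))
      \<longlongrightarrow> 0) (at_left 1)"
    by (rule abelian_weighted_mean_null [OF D0]) simp
  moreover have "eventually (\<lambda>r. of_real ((1 - r) powr 1)
      * (\<Sum>k. of_real (poch_coeff 1 k) * D k * of_real r ^ k)
      = (\<Sum>k. c k * of_real r ^ k) - S) (at_left 1)"
    using eventually_at_left_1
  proof eventually_elim
    case (elim r)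
    define z :: complex where "z = of_real r"
    have z: "norm z < 1" using elim by (simp add: z_def)
    have bounded: "summable (\<lambda>k. h k * z ^ k)" if "convergent h" for h :: "nat \<Rightarrow> complex"
    proof -
      from convergent_imp_Bseq [OF that] obtain K where K: "\<And>k. norm (h k) \<le> K"
        unfolding Bseq_def by blast
      have "summable (\<lambda>k. K * norm z ^ k)"
        using z by (intro summable_mult summable_geometric) auto
      then show ?thesis
        by (rule summable_comparison_test') (auto simp: norm_mult norm_power intro!: mult_right_mono K)
    qed
    have sD: "summable (\<lambda>k. D k * z ^ k)"
      using D0 by (intro bounded) (auto simp: convergent_def)
    have sc: "summable (\<lambda>k. c k * z ^ k)"
      using summable_LIMSEQ_zero [OF sums_summable [OF c]]
      by (intro bounded) (auto simp: convergent_def)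
    have "(\<Sum>n. D n * z ^ n) * z = (\<Sum>n. D n * z ^ n * z)"
      by (rule suminf_mult2 [OF sD])
    also have "\<dots> = (\<Sum>n. D (Suc n) * z ^ Suc n - c (Suc n) * z ^ Suc n)"
      by (rule suminf_cong) (simp add: D_def algebra_simps)
    also have "\<dots> = (\<Sum>n. D (Suc n) * z ^ Suc n) - (\<Sum>n. c (Suc n) * z ^ Suc n)"
      by (intro suminf_diff [symmetric] summable_Suc_iff [THEN iffD2] sD sc)
    also have "\<dots> = ((\<Sum>n. D n * z ^ n) - D 0) - ((\<Sum>n. c n * z ^ n) - c 0)"
      using suminf_split_head [OF sD] suminf_split_head [OF sc] by simp
    finally have "(1 - z) * (\<Sum>n. D n * z ^ n) = (\<Sum>n. c n * z ^ n) - S"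
      by (simp add: D_def algebra_simps)
    then show ?case
      using elim by (simp add: z_def)
  qed
  ultimately have "((\<lambda>r. (\<Sum>k. c k * of_real r ^ k) - S) \<longlongrightarrow> 0) (at_left 1)"
    by (rule Lim_transform_eventually)
  then show ?thesis
    by (rule LIM_zero_cancel)
qed

lemma norm_Gamma_le:
  assumes "Re z > 0"
  shows "norm (Gamma z) \<le> Gamma (Re z)"
proof -
  have "norm (integral {0..} (\<lambda>t. complex_of_real t powr (z - 1) / of_real (exp t)))
      \<le> integral {0..} (\<lambda>t. t powr (Re z - 1) / exp t)"
    using Gamma_integral_complex [OF assms] Gamma_integral_real [OF assms]
    by (intro integral_norm_bound_integral)
       (auto simp: norm_divide norm_powr_real_powr has_integral_integrable)
  then show ?thesis
    using integral_unique [OF Gamma_integral_complex [OF assms]]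
      integral_unique [OF Gamma_integral_real [OF assms]] by simp
qed

lemma Re_pos_not_nonpos_Int: "Re z > 0 \<Longrightarrow> z \<notin> \<int>\<^sub>\<le>\<^sub>0"
  by (auto elim!: nonpos_Ints_cases)

lemma Re_pos_Gamma_nonzero: "Re z > 0 \<Longrightarrow> Gamma z \<noteq> 0"
  using Re_pos_not_nonpos_Int Gamma_eq_zero_iff by blast

lemma poch_coeff_Gamma:
  assumes "Re s > 0"
  shows "poch_coeff s k = Gamma (s + of_nat k) / (fact k * Gamma s)"
  using pochhammer_Gamma [OF Re_pos_not_nonpos_Int [OF assms], of k]
  by (simp add: poch_coeff_def)

lemma norm_poch_coeff_le:
  assumes "Re s > 0"
  shows "norm (poch_coeff s k) \<le> Gamma (Re s) / norm (Gamma s) * poch_coeff (Re s) k"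
proof -
  have "norm (Gamma (s + of_nat k)) \<le> Gamma (Re s + of_nat k)"
    using norm_Gamma_le [of "s + of_nat k"] assms by simp
  moreover have "Re s \<notin> \<int>\<^sub>\<le>\<^sub>0"
    using assms by (auto dest: nonpos_Ints_nonpos)
  then have "Gamma (Re s + of_nat k) = pochhammer (Re s) k * Gamma (Re s)"
    using pochhammer_Gamma [of "Re s" k] Gamma_real_pos [OF assms] by simp
  ultimately show ?thesis
    using assms Re_pos_Gamma_nonzero[OF assms]
    by (simp add: poch_coeff_Gamma poch_coeff_def[of "Re s"] norm_divide norm_mult field_simps)
qed

subsection \<open>The incomplete beta function\<close>

definition beta_coeff :: "complex \<Rightarrow> complex \<Rightarrow> nat \<Rightarrow> complex" where
  "beta_coeff s t k = Gamma (s + t + of_nat k) / (Gamma (s + of_nat k + 1) * Gamma t)"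

lemma cbinom_eq_poch_coeff:
  assumes "Re t > 0"
  shows "cbinom (t + of_nat k - 1) (of_nat k) = poch_coeff t k"
  using assms Gamma_fact [of k, where ?'a = complex]
  by (simp add: cbinom_def poch_coeff_Gamma add.commute)

lemma cbinom_eq_beta_coeff: "cbinom (s + t + of_nat k - 1) (s + of_nat k) = beta_coeff s t k"
  by (simp add: cbinom_def beta_coeff_def)

lemma beta_coeff_nonzero:
  assumes "Re s > 0" "Re t > 0"
  shows "beta_coeff s t k \<noteq> 0"
  using assms by (simp add: beta_coeff_def Re_pos_Gamma_nonzero)

lemma beta_coeff_1: "Re s > 0 \<Longrightarrow> beta_coeff s 1 k = 1"
  using Re_pos_Gamma_nonzero [of "s + 1 + of_nat k"] by (simp add: beta_coeff_def add_ac)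

lemma beta_coeff_0:
  assumes "Re s > 0"
  shows "s * beta_coeff s t 0 = Gamma (s + t) / (Gamma s * Gamma t)"
  using assms Gamma_plus1 [OF Re_pos_not_nonpos_Int [OF assms]]
  by (auto simp: beta_coeff_def)

lemma beta_coeff_Suc:
  assumes "Re s > 0" "Re t > 0"
  shows "(s + of_nat k + 1) * beta_coeff s t (Suc k) = (s + t + of_nat k) * beta_coeff s t k"
proof -
  have "Gamma (s + t + of_nat (Suc k)) = (s + t + of_nat k) * Gamma (s + t + of_nat k)"
    using Gamma_plus1 [of "s + t + of_nat k"] assms
    by (auto simp: algebra_simps Re_pos_not_nonpos_Int)
  moreover have "Gamma (s + of_nat (Suc k) + 1) = (s + of_nat k + 1) * Gamma (s + of_nat k + 1)"
    using Gamma_plus1 [of "s + of_nat k + 1"] assms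
    by (auto simp: algebra_simps Re_pos_not_nonpos_Int)
  moreover have "s + of_nat k + 1 \<noteq> 0"
    using assms by (auto simp: complex_eq_iff)
  ultimately show ?thesis
    by (simp add: beta_coeff_def divide_simps del: of_nat_Suc)
qed

lemma poch_coeff_nonzero: "Re s > 0 \<Longrightarrow> poch_coeff s k \<noteq> 0"
  by (simp add: poch_coeff_Gamma Re_pos_Gamma_nonzero)

lemma shifted_ratio_tendsto_1:
  fixes a b :: complex
  shows "(\<lambda>k. (a + of_nat k) / (b + of_nat k)) \<longlonglongrightarrow> 1"
proof -
  have inf: "filterlim (\<lambda>k. b + of_nat k) at_infinity sequentially"
    by (intro tendsto_add_filterlim_at_infinity [OF tendsto_const] tendsto_of_nat)
  have "(\<lambda>k. 1 + (a - b) / (b + of_nat k)) \<longlonglongrightarrow> 1 + 0"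
    by (intro tendsto_add tendsto_const tendsto_divide_0 [OF tendsto_const inf])
  moreover have "eventually (\<lambda>k. b + of_nat k \<noteq> 0) sequentially"
    using filterlim_at_infinity_imp_eventually_ne [OF inf, of 0] .
  then have "eventually (\<lambda>k. 1 + (a - b) / (b + of_nat k) = (a + of_nat k) / (b + of_nat k)) sequentially"
    by eventually_elim (simp add: field_simps)
  ultimately show ?thesis
    by (auto intro: Lim_transform_eventually)
qed

lemma beta_coeff_ratio_limit:
  assumes "Re s > 0" "Re t > 0"
  shows "(\<lambda>k. beta_coeff s t (Suc k) / beta_coeff s t k) \<longlonglongrightarrow> 1"
proof -
  have "beta_coeff s t (Suc k) / beta_coeff s t k = (s + t + of_nat k) / (s + 1 + of_nat k)" for k
  proof -
    have "s + 1 + of_nat k \<noteq> 0" using assms by (auto simp: complex_eq_iff)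
    then show ?thesis
      using beta_coeff_Suc [OF assms, of k] beta_coeff_nonzero [OF assms, of k]
      by (simp add: frac_eq_eq algebra_simps)
  qed
  then show ?thesis
    using shifted_ratio_tendsto_1 [of "s + t" "s + 1"] by simp
qed

lemma beta_coeff_summable:
  assumes "Re s > 0" "Re t > 0" "norm z < 1"
  shows "summable (\<lambda>k. beta_coeff s t k * z ^ k)"
proof -
  have "(\<lambda>k. beta_coeff s t k / beta_coeff s t (Suc k)) \<longlonglongrightarrow> 1"
    using tendsto_inverse [OF beta_coeff_ratio_limit [OF assms(1,2)]] by simp
  then have "(\<lambda>k. norm (beta_coeff s t k / beta_coeff s t (Suc k))) \<longlonglongrightarrow> norm (1::complex)"
    by (rule tendsto_norm)
  then have "conv_radius (beta_coeff s t) = ereal 1"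
    using beta_coeff_nonzero [OF assms(1,2)]
    by (intro conv_radius_ratio_limit_nonzero) (auto simp: norm_divide)
  then show ?thesis
    using assms by (intro summable_in_conv_radius) simp
qed

lemma beta_coeff_sim_poch_coeff:
  assumes "Re s > 0" "Re t > 0"
  shows "(\<lambda>k. beta_coeff s t k / poch_coeff t k) \<longlonglongrightarrow> 1"
proof -
  have nz: "Gamma s \<noteq> 0" "Gamma t \<noteq> 0" "Gamma (s + 1) \<noteq> 0" "Gamma (s + t) \<noteq> 0"
    using assms by (auto intro!: Re_pos_Gamma_nonzero)
  have "(\<lambda>k. Gamma (s + t) / (Gamma (s + 1) * Gamma t)
        * (Gamma_series' (s + 1) k * Gamma_series' t k / Gamma_series' (s + t) k))
      \<longlonglongrightarrow> Gamma (s + t) / (Gamma (s + 1) * Gamma t)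
        * (Gamma (s + 1) * Gamma t / Gamma (s + t))"
    using nz by (intro tendsto_intros Gamma_series'_LIMSEQ) auto
  then have "(\<lambda>k. Gamma (s + t) / (Gamma (s + 1) * Gamma t)
        * (Gamma_series' (s + 1) k * Gamma_series' t k / Gamma_series' (s + t) k)) \<longlonglongrightarrow> 1"
    using nz by simp
  moreover have "eventually (\<lambda>k. Gamma (s + t) / (Gamma (s + 1) * Gamma t)
        * (Gamma_series' (s + 1) k * Gamma_series' t k / Gamma_series' (s + t) k)
        = beta_coeff s t k / poch_coeff t k) sequentially"
    using eventually_gt_at_top [of 0]
  proof eventually_elim
    case (elim k)
    have poch: "pochhammer z k = Gamma (z + of_nat k) / Gamma z" if "Re z > 0" for z
      using pochhammer_Gamma [OF Re_pos_not_nonpos_Int [OF that]] .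
    have pnz: "Gamma (z + of_nat k) \<noteq> 0" if "Re z > 0" for z
      using that by (intro Re_pos_Gamma_nonzero) simp
    define L where "L = complex_of_real (ln (real k))"
    have ex: "exp ((s + 1) * L) * exp (t * L) = of_nat k * exp ((s + t) * L)"
      using elim by (simp add: L_def exp_add [symmetric] algebra_simps)
         (simp add: exp_add exp_of_real)
    have fk: "fact k = of_nat k * (fact (k - 1) :: complex)"
      using elim by (simp add: fact_reduce)
    have "Gamma_series' (s + 1) k * Gamma_series' t k / Gamma_series' (s + t) k
       = fact (k - 1) * (exp ((s + 1) * L) * exp (t * L)) / exp ((s + t) * L)
           * pochhammer (s + t) k / (pochhammer (s + 1) k * pochhammer t k)"
      by (simp add: Gamma_series'_def L_def field_simps)
    also have "\<dots> = fact k * pochhammer (s + t) k / (pochhammer (s + 1) k * pochhammer t k)"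
      unfolding ex fk by simp
    finally have *: "Gamma_series' (s + 1) k * Gamma_series' t k / Gamma_series' (s + t) k
      = fact k * pochhammer (s + t) k / (pochhammer (s + 1) k * pochhammer t k)" .
    show ?case
      unfolding * using nz assms pnz [of "s + t"] pnz [of t] pnz [of "s + 1"]
      by (simp add: poch poch_coeff_Gamma beta_coeff_def add_ac)
  qed
  ultimately show ?thesis
    by (rule Lim_transform_eventually)
qed

definition beta_series :: "complex \<Rightarrow> complex \<Rightarrow> complex \<Rightarrow> complex" where
  "beta_series s t z = (\<Sum>k. beta_coeff s t k * z ^ k)"

text \<open>The regularised incomplete beta function, for \<open>\<bar>z\<bar> < 1\<close>.\<close>

definition inc_beta :: "complex \<Rightarrow> complex \<Rightarrow> complex \<Rightarrow> complex" where
  "inc_beta s t z = z powr s * (1 - z) powr t * beta_series s t z"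

lemma beta_series_ode:
  assumes "Re s > 0" "Re t > 0" "norm z < 1"
  obtains B' where "(beta_series s t has_field_derivative B') (at z)"
    and "s * beta_series s t z + z * B' - z * ((s + t) * beta_series s t z + z * B')
         = Gamma (s + t) / (Gamma s * Gamma t)"
proof
  let ?b = "beta_coeff s t" and ?B = "beta_series s t z"
  define B' where "B' = (\<Sum>k. diffs ?b k * z ^ k)"
  have sm: "summable (\<lambda>k. ?b k * w ^ k)" if "norm w < 1" for w
    using beta_coeff_summable [OF assms(1,2) that] .
  show "(beta_series s t has_field_derivative B') (at z)"
    unfolding beta_series_def [abs_def] B'_def by (rule termdiffs_strong' [OF sm assms(3)])
  have B: "(\<lambda>k. ?b k * z ^ k) sums ?B"
    unfolding beta_series_def using sm [OF assms(3)] by (rule summable_sums)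
  have "(\<lambda>k. diffs ?b k * z ^ k) sums B'"
    unfolding B'_def by (intro summable_sums termdiff_converges [OF assms(3) sm])
  then have "(\<lambda>k. z * (diffs ?b k * z ^ k)) sums (z * B')"
    by (rule sums_mult)
  moreover have "z * (diffs ?b k * z ^ k) = of_nat (Suc k) * ?b (Suc k) * z ^ Suc k" for k
    by (simp add: diffs_def mult_ac)
  ultimately have "(\<lambda>k. of_nat (Suc k) * ?b (Suc k) * z ^ Suc k) sums (z * B')"
    by simp
  then have B1: "(\<lambda>k. of_nat k * ?b k * z ^ k) sums (z * B')"
    by (subst (asm) sums_Suc_iff) simp
  have "(\<lambda>k. s * (?b k * z ^ k) + of_nat k * ?b k * z ^ k) sums (s * ?B + z * B')"
    by (intro sums_add sums_mult B B1)
  then have 1: "(\<lambda>k. s * (?b (Suc k) * z ^ Suc k) + of_nat (Suc k) * ?b (Suc k) * z ^ Suc k)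
      sums (s * ?B + z * B' - s * ?b 0)"
    by (subst sums_Suc_iff) simp
  have 2: "(\<lambda>k. z * ((s + t) * (?b k * z ^ k) + of_nat k * ?b k * z ^ k))
      sums (z * ((s + t) * ?B + z * B'))"
    by (intro sums_add sums_mult B B1)
  have "s * (?b (Suc k) * z ^ Suc k) + of_nat (Suc k) * ?b (Suc k) * z ^ Suc k
      = z * ((s + t) * (?b k * z ^ k) + of_nat k * ?b k * z ^ k)" for k
  proof -
    have "s * (?b (Suc k) * z ^ Suc k) + of_nat (Suc k) * ?b (Suc k) * z ^ Suc k
        = ((s + of_nat k + 1) * ?b (Suc k)) * z ^ Suc k"
      by (simp add: algebra_simps)
    also have "\<dots> = z * ((s + t) * (?b k * z ^ k) + of_nat k * ?b k * z ^ k)"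
      unfolding beta_coeff_Suc [OF assms(1,2)] by (simp add: algebra_simps)
    finally show ?thesis .
  qed
  with 1 2 have "s * ?B + z * B' - s * ?b 0 = z * ((s + t) * ?B + z * B')"
    by (simp add: sums_unique2)
  then show "s * ?B + z * B' - z * ((s + t) * ?B + z * B') = Gamma (s + t) / (Gamma s * Gamma t)"
    using beta_coeff_0 [OF assms(1), of t] by (simp add: algebra_simps)
qed

lemma one_minus_notin_nonpos_Reals: "norm (z::complex) < 1 \<Longrightarrow> 1 - z \<notin> \<real>\<^sub>\<le>\<^sub>0"
  using complex_Re_le_cmod [of z] by (auto simp: complex_nonpos_Reals_iff)

lemma inc_beta_deriv:
  assumes "Re s > 0" "Re t > 0" "norm z < 1" "z \<notin> \<real>\<^sub>\<le>\<^sub>0"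
  shows "(inc_beta s t has_field_derivative
            Gamma (s + t) / (Gamma s * Gamma t) * (z powr (s - 1) * (1 - z) powr (t - 1))) (at z)"
proof -
  obtain B' where B': "(beta_series s t has_field_derivative B') (at z)"
    and ode: "s * beta_series s t z + z * B' - z * ((s + t) * beta_series s t z + z * B')
         = Gamma (s + t) / (Gamma s * Gamma t)"
    using beta_series_ode [OF assms(1-3)] .
  note z1 = one_minus_notin_nonpos_Reals [OF assms(3)]
  have nz: "z \<noteq> 0" "1 - z \<noteq> 0"
    using assms z1 by auto
  have p: "z powr s = z * z powr (s - 1)" "(1 - z) powr t = (1 - z) * (1 - z) powr (t - 1)"
    using nz by (simp_all add: powr_diff)
  have "(inc_beta s t has_field_derivative
      (s * z powr (s - 1) * (1 - z) powr t - t * (1 - z) powr (t - 1) * z powr s) * beta_series s t z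
        + z powr s * (1 - z) powr t * B') (at z)"
    unfolding inc_beta_def [abs_def] using assms z1
    by (auto intro!: derivative_eq_intros B')
  also have "(s * z powr (s - 1) * (1 - z) powr t - t * (1 - z) powr (t - 1) * z powr s) * beta_series s t z
        + z powr s * (1 - z) powr t * B'
      = (s * beta_series s t z + z * B' - z * ((s + t) * beta_series s t z + z * B'))
        * (z powr (s - 1) * (1 - z) powr (t - 1))"
    unfolding p by (simp add: algebra_simps)
  finally show ?thesis
    unfolding ode .
qed

lemma tendsto_at_left_1:
  assumes "isCont f (1::complex)"
  shows "((\<lambda>r. f (of_real r)) \<longlongrightarrow> f 1) (at_left 1)"
proof -
  have "((\<lambda>r. complex_of_real r) \<longlongrightarrow> of_real 1) (at_left 1)"
    by (intro tendsto_intros)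
  with assms show ?thesis
    using isCont_tendsto_compose [of "1::complex" f] by simp
qed

lemma inc_beta_tendsto_1:
  assumes s: "Re s > 0" and t: "Re t > 0"
  shows "((\<lambda>r. inc_beta s t (of_real r)) \<longlongrightarrow> 1) (at_left 1)"
proof -
  define \<sigma> where "\<sigma> = Re t"
  define d where "d k = poch_coeff t k / of_real (poch_coeff \<sigma> k)
    * (beta_coeff s t k / poch_coeff t k - 1)" for k
  have pos: "poch_coeff \<sigma> k > 0" for k
    using pochhammer_pos [of \<sigma> k] t by (simp add: poch_coeff_def \<sigma>_def)
  have "norm (poch_coeff t k / of_real (poch_coeff \<sigma> k)) \<le> Gamma \<sigma> / norm (Gamma t)" for k
    using norm_poch_coeff_le [OF t, of k] pos [of k]
    by (simp add: norm_divide \<sigma>_def divide_simps mult_ac split: if_splits)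
  then have "Bseq (\<lambda>k. poch_coeff t k / of_real (poch_coeff \<sigma> k))"
    by (rule BseqI')
  moreover have "(\<lambda>k. beta_coeff s t k / poch_coeff t k - 1) \<longlonglongrightarrow> 0"
    using tendsto_diff [OF beta_coeff_sim_poch_coeff [OF s t] tendsto_const [of 1]] by simp
  ultimately have d0: "d \<longlonglongrightarrow> 0"
    using bounded_bilinear.Bfun_prod_Zfun [OF bounded_bilinear_mult,
      of "\<lambda>k. poch_coeff t k / of_real (poch_coeff \<sigma> k)" sequentially
         "\<lambda>k. beta_coeff s t k / poch_coeff t k - 1"]
    by (simp add: d_def [abs_def] tendsto_Zfun_iff)
  have "((\<lambda>r. of_real ((1 - r) powr \<sigma>)
      * (\<Sum>k. of_real (poch_coeff \<sigma> k) * d k * of_real r ^ k)) \<longlongrightarrow> 0) (at_left 1)"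
    using t by (intro abelian_weighted_mean_null d0) (simp add: \<sigma>_def)
  then have "((\<lambda>r. norm (of_real ((1 - r) powr \<sigma>)
      * (\<Sum>k. of_real (poch_coeff \<sigma> k) * d k * of_real r ^ k))) \<longlongrightarrow> 0) (at_left 1)"
    by (rule tendsto_norm_zero)
  moreover have "eventually (\<lambda>r. norm (of_real ((1 - r) powr \<sigma>)
      * (\<Sum>k. of_real (poch_coeff \<sigma> k) * d k * of_real r ^ k))
      = norm ((1 - of_real r) powr t * beta_series s t (of_real r) - 1)) (at_left 1)"
    using eventually_at_left_1
  proof eventually_elim
    case (elim r)
    define z where "z = complex_of_real r"
    have z: "norm z < 1" "1 - z = of_real (1 - r)" using elim by (auto simp: z_def)
    have "of_real (poch_coeff \<sigma> k) * d k = beta_coeff s t k - poch_coeff t k" for k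
      using pos [of k] poch_coeff_nonzero [OF t, of k] by (simp add: d_def field_simps)
    then have "(\<Sum>k. of_real (poch_coeff \<sigma> k) * d k * z ^ k)
        = (\<Sum>k. beta_coeff s t k * z ^ k - poch_coeff t k * z ^ k)"
      by (simp add: left_diff_distrib)
    also have "\<dots> = beta_series s t z - (1 - z) powr (-t)"
      unfolding beta_series_def
      using poch_coeff_sums_complex [OF z(1), of t] beta_coeff_summable [OF s t z(1)]
      by (subst suminf_diff [symmetric]) (auto simp: sums_iff)
    finally have eq: "(\<Sum>k. of_real (poch_coeff \<sigma> k) * d k * z ^ k)
        = beta_series s t z - (1 - z) powr (-t)" .
    have "norm ((1 - z) powr t) = (1 - r) powr \<sigma>"
      using elim by (simp add: z \<sigma>_def norm_powr_real_powr del: of_real_diff)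
    then have "norm (of_real ((1 - r) powr \<sigma>) * (beta_series s t z - (1 - z) powr (-t)))
        = norm ((1 - z) powr t * (beta_series s t z - (1 - z) powr (-t)))"
      by (simp add: norm_mult)
    also have "(1 - z) powr t * (beta_series s t z - (1 - z) powr (-t))
        = (1 - z) powr t * beta_series s t z - 1"
    proof -
      have "1 - z \<noteq> 0" using elim by (auto simp: z)
      then show ?thesis by (simp add: powr_minus right_diff_distrib)
    qed
    finally show ?case
      unfolding z_def [symmetric] eq .
  qed
  ultimately have "((\<lambda>r. norm ((1 - of_real r) powr t * beta_series s t (of_real r) - 1)) \<longlongrightarrow> 0)
      (at_left 1)"
    by (rule Lim_transform_eventually)
  then have lim: "((\<lambda>r. (1 - of_real r) powr t * beta_series s t (of_real r)) \<longlongrightarrow> 1) (at_left 1)"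
    by (simp add: tendsto_norm_zero_iff LIM_zero_iff)
  have "((\<lambda>r. of_real r powr s) \<longlongrightarrow> 1 powr s) (at_left 1)"
    by (rule tendsto_at_left_1) (auto intro!: continuous_intros)
  from tendsto_mult [OF this lim] show ?thesis
    by (simp add: inc_beta_def mult.assoc)
qed

lemma inc_beta_tendsto_0:
  assumes s: "Re s > 0" and t: "Re t > 0"
  shows "((\<lambda>r. inc_beta s t (1 - of_real r)) \<longlongrightarrow> 0) (at_left 1)"
proof -
  have "((\<lambda>r. norm (complex_of_real (1 - r) powr s)) \<longlongrightarrow> 0) (at_left 1)"
    using tendsto_one_minus_powr_at_left [OF s]
    by (rule Lim_transform_eventually)
       (use eventually_at_left_1 in eventually_elim, simp add: norm_powr_real_powr del: of_real_diff)
  then have 1: "((\<lambda>r. (1 - complex_of_real r) powr s) \<longlongrightarrow> 0) (at_left 1)"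
    by (simp add: tendsto_norm_zero_iff)
  have 2: "((\<lambda>r. (1 - (1 - complex_of_real r)) powr t) \<longlongrightarrow> (1 - (1 - 1)) powr t) (at_left 1)"
    by (rule tendsto_at_left_1) (auto intro!: continuous_intros)
  obtain B' where "(beta_series s t has_field_derivative B') (at 0)"
    using beta_series_ode [OF s t, of 0] by auto
  then have "isCont (beta_series s t) (1 - 1)"
    by (simp add: DERIV_isCont)
  then have "isCont (\<lambda>z. beta_series s t (1 - z)) 1"
    by (intro isCont_o2 [of _ "\<lambda>z. 1 - z" "beta_series s t"]) (auto intro!: continuous_intros)
  from tendsto_mult [OF tendsto_mult [OF 1 2] tendsto_at_left_1 [OF this]]
  show ?thesis
    by (simp add: inc_beta_def)
qed

definition slit_domain :: "complex set" where
  "slit_domain = {z. z \<notin> \<real>\<^sub>\<le>\<^sub>0 \<and> 1 - z \<notin> \<real>\<^sub>\<le>\<^sub>0}"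

lemma open_slit_domain: "open slit_domain"
proof -
  have "open (- \<real>\<^sub>\<le>\<^sub>0 \<inter> (\<lambda>z. 1 - z) -` (- \<real>\<^sub>\<le>\<^sub>0) :: complex set)"
    by (intro open_Int open_vimage open_Compl) (auto intro!: continuous_intros)
  moreover have "slit_domain = - \<real>\<^sub>\<le>\<^sub>0 \<inter> (\<lambda>z. 1 - z) -` (- \<real>\<^sub>\<le>\<^sub>0)"
    by (auto simp: slit_domain_def)
  ultimately show ?thesis
    by simp
qed

lemma slit_domain_iff: "z \<in> slit_domain \<longleftrightarrow> Im z \<noteq> 0 \<or> (0 < Re z \<and> Re z < 1)"
  by (auto simp: slit_domain_def complex_nonpos_Reals_iff)

lemma slit_domain_segment:
  assumes "z \<in> slit_domain" "0 \<le> x" "x \<le> 1"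
  shows "(1 - x) *\<^sub>R (1 / 2) + x *\<^sub>R z \<in> slit_domain"
proof (cases "x = 0 \<or> Im z \<noteq> 0")
  case True
  then show ?thesis using assms by (auto simp: slit_domain_iff)
next
  case False
  then have x: "x > 0" and z: "0 < Re z" "Re z < 1"
    using assms by (auto simp: slit_domain_iff)
  have "0 < x * Re z" "x * Re z < x * 1" using x z by (auto intro: mult_strict_left_mono)
  then show ?thesis
    using assms False by (auto simp: slit_domain_iff field_simps)
qed

lemma starlike_slit_domain_Int:
  assumes "convex C" "1 / 2 \<in> C"
  shows "starlike (slit_domain \<inter> C)"
  unfolding starlike_def
proof (intro bexI [of _ "1 / 2"] ballI)
  show "1 / 2 \<in> slit_domain \<inter> C"
    using assms by (simp add: slit_domain_iff)
  fix z assume z: "z \<in> slit_domain \<inter> C"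
  show "closed_segment (1 / 2) z \<subseteq> slit_domain \<inter> C"
    using slit_domain_segment [of z] z convex_contains_segment [of C] assms
    by (auto simp: in_segment)
qed

lemma inc_beta_continuation:
  assumes s: "Re s > 0" and t: "Re t > 0"
  obtains P where "continuous_on slit_domain P"
    and "\<And>z. z \<in> slit_domain \<Longrightarrow> norm z < 1 \<Longrightarrow> inc_beta s t z = P z"
    and "\<And>z. z \<in> slit_domain \<Longrightarrow> norm (1 - z) < 1 \<Longrightarrow> inc_beta t s (1 - z) = 1 - P z"
proof -
  define \<phi> where "\<phi> z = Gamma (s + t) / (Gamma s * Gamma t)
    * (z powr (s - 1) * (1 - z) powr (t - 1))" for z
  have hol: "\<phi> holomorphic_on slit_domain"
    unfolding \<phi>_def [abs_def] by (intro holomorphic_intros) (auto simp: slit_domain_def)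
  have star: "starlike slit_domain"
    using starlike_slit_domain_Int [of UNIV] by simp
  obtain Q where Q: "\<And>z. z \<in> slit_domain \<Longrightarrow> (Q has_field_derivative \<phi> z) (at z)"
    using holomorphic_starlike_primitive [OF holomorphic_on_imp_continuous_on [OF hol] star
      open_slit_domain finite.emptyI] hol open_slit_domain
    by (metis Diff_empty holomorphic_on_imp_differentiable_at)
  have const: "\<exists>c. \<forall>z \<in> slit_domain \<inter> C. h z = c"
    if C: "convex C" "open C" "1 / 2 \<in> C"
      and h: "\<And>z. z \<in> slit_domain \<inter> C \<Longrightarrow> (h has_field_derivative 0) (at z)" for h and C
  proof -
    have "connected (slit_domain \<inter> C)"
      by (intro starlike_imp_connected starlike_slit_domain_Int C)
    moreover have "open (slit_domain \<inter> C)"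
      using C open_slit_domain by auto
    ultimately have "h constant_on slit_domain \<inter> C"
      using h by (intro has_field_derivative_0_imp_constant_on) auto
    then show ?thesis
      by (simp add: constant_on_def)
  qed
  have "\<exists>c. \<forall>z \<in> slit_domain \<inter> ball 0 1. inc_beta s t z - Q z = c"
  proof (rule const)
    fix z :: complex assume z: "z \<in> slit_domain \<inter> ball 0 1"
    then have "((\<lambda>z. inc_beta s t z - Q z) has_field_derivative \<phi> z - \<phi> z) (at z)"
      unfolding \<phi>_def using Q [of z, unfolded \<phi>_def]
      by (intro DERIV_diff inc_beta_deriv s t) (auto simp: slit_domain_def)
    then show "((\<lambda>z. inc_beta s t z - Q z) has_field_derivative 0) (at z)"
      by simp
  qed auto
  then obtain c where c: "\<And>z. z \<in> slit_domain \<Longrightarrow> norm z < 1 \<Longrightarrow> inc_beta s t z - Q z = c"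
    by auto
  have "\<exists>c. \<forall>z \<in> slit_domain \<inter> ball 1 1. inc_beta t s (1 - z) + Q z = c"
  proof (rule const)
    fix z :: complex assume z: "z \<in> slit_domain \<inter> ball 1 1"
    then have "(inc_beta t s has_field_derivative \<phi> z) (at (1 - z))"
      using inc_beta_deriv [OF t s, of "1 - z"]
      by (simp add: slit_domain_def \<phi>_def dist_norm add.commute mult.commute)
    then have "((\<lambda>z. inc_beta t s (1 - z)) has_field_derivative \<phi> z * (- 1)) (at z)"
      by (rule DERIV_chain2) (auto intro!: derivative_eq_intros)
    then have "((\<lambda>z. inc_beta t s (1 - z) + Q z) has_field_derivative \<phi> z * (- 1) + \<phi> z) (at z)"
      using z by (intro DERIV_add Q) auto
    then show "((\<lambda>z. inc_beta t s (1 - z) + Q z) has_field_derivative 0) (at z)"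
      by simp
  qed (auto simp: dist_norm)
  then obtain c' where c': "\<And>z. z \<in> slit_domain \<Longrightarrow> norm (1 - z) < 1 \<Longrightarrow> inc_beta t s (1 - z) + Q z = c'"
    by (auto simp: dist_norm)
  have "((\<lambda>r. inc_beta s t (of_real r) + inc_beta t s (1 - of_real r)) \<longlongrightarrow> 1 + 0) (at_left 1)"
    by (intro tendsto_add inc_beta_tendsto_1 inc_beta_tendsto_0 s t)
  moreover have "eventually (\<lambda>r. inc_beta s t (of_real r) + inc_beta t s (1 - of_real r) = c + c') (at_left 1)"
    using eventually_at_left_1
  proof eventually_elim
    case (elim r)
    have n: "norm (1 - complex_of_real r) < 1"
      using elim by (metis abs_of_pos diff_gt_0_iff_gt diff_less_eq less_add_same_cancel1 norm_of_real of_real_1 of_real_diff)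
    show ?case
      using elim n c [of "of_real r"] c' [of "of_real r"]
      by (simp add: slit_domain_iff algebra_simps)
  qed
  ultimately have "((\<lambda>r::real. c + c') \<longlongrightarrow> 1) (at_left 1)"
    by (auto elim: Lim_transform_eventually)
  then have cc: "c + c' = 1"
    by (simp add: tendsto_const_iff)
  show thesis
  proof (rule that [of "\<lambda>z. Q z + c"])
    show "continuous_on slit_domain (\<lambda>z. Q z + c)"
      using Q by (intro continuous_intros) (meson DERIV_isCont continuous_at_imp_continuous_on)
    show "inc_beta s t z = Q z + c" if "z \<in> slit_domain" "norm z < 1" for z
      using c [OF that] by (simp add: algebra_simps)
    show "inc_beta t s (1 - z) = 1 - (Q z + c)" if "z \<in> slit_domain" "norm (1 - z) < 1" for z
      using c' [OF that] cc by (simp add: algebra_simps)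
  qed
qed

subsection \<open>The two series\<close>

definition pfd_term :: "complex \<Rightarrow> complex \<Rightarrow> complex \<Rightarrow> nat \<Rightarrow> complex" where
  "pfd_term s t u k = (poch_coeff t k * u powr (-s) - beta_coeff s t k) * u ^ k"

lemma pfd_term_sums:
  assumes "Re s > 0" "Re t > 0" "norm z < 1"
  shows "(\<lambda>k. (poch_coeff t k * w - beta_coeff s t k) * z ^ k) sums
    (w * (1 - z) powr (-t) - beta_series s t z)"
proof -
  have "(\<lambda>k. w * (poch_coeff t k * z ^ k) - beta_coeff s t k * z ^ k) sums
      (w * (1 - z) powr (-t) - beta_series s t z)"
    unfolding beta_series_def using assms
    by (intro sums_diff sums_mult poch_coeff_sums_complex summable_sums beta_coeff_summable)
  then show ?thesis
    by (simp add: algebra_simps)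
qed

lemma pfd_term_suminf:
  assumes s: "Re s > 0" and t: "Re t > 0" and u: "u \<in> slit_domain" "norm u \<le> 1"
    and sm: "summable (pfd_term s t u)"
    and P: "isCont P u" "\<And>z. z \<in> slit_domain \<Longrightarrow> norm z < 1 \<Longrightarrow> inc_beta s t z = P z"
  shows "suminf (pfd_term s t u) = u powr (-s) * (1 - u) powr (-t) * (1 - P u)"
proof -
  define G where "G z = u powr (-s) * (1 - z) powr (-t) - P z * (z powr (-s) * (1 - z) powr (-t))" for z
  have "isCont G u"
    unfolding G_def [abs_def] using u P(1)
    by (intro continuous_intros) (auto simp: slit_domain_def)
  then have "isCont (\<lambda>z. G (z * u)) 1"
    by (intro isCont_o2 [of _ "\<lambda>z. z * u" G]) (auto intro!: continuous_intros)
  from tendsto_at_left_1 [OF this] have "((\<lambda>r. G (of_real r * u)) \<longlongrightarrow> G u) (at_left 1)"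
    by simp
  moreover have "eventually (\<lambda>r. G (of_real r * u) = (\<Sum>k. pfd_term s t u k * of_real r ^ k)) (at_left 1)"
    using eventually_at_left_1
  proof eventually_elim
    case (elim r)
    define z where "z = of_real r * u"
    have "norm z = r * norm u"
      using elim by (simp add: z_def norm_mult)
    also have "\<dots> \<le> r * 1"
      using elim u by (intro mult_left_mono) auto
    also have "\<dots> < 1"
      using elim by simp
    finally have z: "norm z < 1" .
    have "Im u = 0 \<Longrightarrow> 0 < r * Re u \<and> r * Re u < 1"
      using u elim mult_strict_mono [of r 1 "Re u" 1] by (auto simp: slit_domain_iff)
    then have zs: "z \<in> slit_domain"
      using u elim by (auto simp: slit_domain_iff z_def)
    then have nz: "z \<noteq> 0" "1 - z \<noteq> 0"
      by (auto simp: slit_domain_def)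
    have "P z = z powr s * (1 - z) powr t * beta_series s t z"
      using P(2) [OF zs z] by (simp add: inc_beta_def)
    then have "P z * (z powr (-s) * (1 - z) powr (-t)) = beta_series s t z"
      using nz by (simp add: powr_minus field_simps)
    then have "G z = u powr (-s) * (1 - z) powr (-t) - beta_series s t z"
      by (simp add: G_def)
    also have "\<dots> = (\<Sum>k. (poch_coeff t k * u powr (-s) - beta_coeff s t k) * z ^ k)"
      using pfd_term_sums [OF s t z] by (rule sums_unique)
    finally show ?case
      by (simp add: z_def pfd_term_def power_mult_distrib mult_ac)
  qed
  ultimately have "((\<lambda>r. \<Sum>k. pfd_term s t u k * of_real r ^ k) \<longlongrightarrow> G u) (at_left 1)"
    by (rule Lim_transform_eventually)
  with Abel_limit [OF summable_sums [OF sm]] have "suminf (pfd_term s t u) = G u"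
    using tendsto_unique trivial_limit_at_left_real by blast
  then show ?thesis
    by (simp add: G_def algebra_simps)
qed

lemma ratio_limit_gt_1_not_null:
  fixes c :: "nat \<Rightarrow> 'a::real_normed_field"
  assumes nz: "\<And>k. c k \<noteq> 0" and lim: "(\<lambda>k. c (Suc k) / c k) \<longlonglongrightarrow> q" and q: "norm q > 1"
  shows "\<not> c \<longlonglongrightarrow> 0"
proof
  assume c: "c \<longlonglongrightarrow> 0"
  have "eventually (\<lambda>k. norm (c (Suc k) / c k) > 1) sequentially"
    using order_tendstoD(1) [OF tendsto_norm [OF lim] q] .
  then obtain N where N: "\<And>k. k \<ge> N \<Longrightarrow> norm (c (Suc k) / c k) > 1"
    by (auto simp: eventually_at_top_linorder)
  have "norm (c k) \<ge> norm (c N)" if "k \<ge> N" for k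
    using that
  proof (induction rule: dec_induct)
    case (step k)
    then show ?case
      using N [of k] nz [of k] by (simp add: norm_divide field_simps)
  qed simp
  then have "eventually (\<lambda>k. norm (c k) \<ge> norm (c N)) sequentially"
    by (auto simp: eventually_at_top_linorder)
  then have "norm (c N) \<le> 0"
    by (rule tendsto_lowerbound [OF tendsto_norm_zero [OF c]]) simp
  with nz show False by simp
qed

text \<open>Outside the closed unit disc the series converges only in the degenerate case in which all
  its terms vanish: the recurrences of the two coefficient sequences combine into a null sequence
  that is a multiple, vanishing only for \<open>t = 1\<close>, of an exponentially growing one.\<close>

lemma pfd_term_summable_outside:
  assumes s: "Re s > 0" and t: "Re t > 0" and u: "norm u > 1"
    and sm: "summable (pfd_term s t u)"
  shows "t = 1" "u powr (-s) = 1"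
proof -
  let ?b = "beta_coeff s t" and ?w = "u powr (-s)"
  have f0: "pfd_term s t u \<longlonglongrightarrow> 0"
    by (rule summable_LIMSEQ_zero [OF sm])
  have u0: "u \<noteq> 0" using u by auto
  define e where "e k = s * (t - 1) * ?b k * u ^ k / ((s + 1 + of_nat k) * (1 + of_nat k))" for k
  have d: "s + 1 + of_nat k \<noteq> 0" "1 + of_nat k \<noteq> (0::complex)" for k
    using s by (auto simp: complex_eq_iff)
  have e_eq: "e k = pfd_term s t u (Suc k) / u - (t + of_nat k) / (1 + of_nat k) * pfd_term s t u k" for k
  proof -
    have 1: "(1 + of_nat k) * poch_coeff t (Suc k) = (t + of_nat k) * poch_coeff t k"
      using poch_coeff_Suc [of k t] by simp
    have 2: "?b (Suc k) = (s + t + of_nat k) * ?b k / (s + 1 + of_nat k)"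
      using beta_coeff_Suc [OF s t, of k] d(1) [of k] by (simp add: field_simps)
    have "pfd_term s t u (Suc k) / u - (t + of_nat k) / (1 + of_nat k) * pfd_term s t u k
      = ((((1 + of_nat k) * poch_coeff t (Suc k)) * ?w - (1 + of_nat k) * ?b (Suc k))
          - (t + of_nat k) * (poch_coeff t k * ?w - ?b k)) * u ^ k / (1 + of_nat k)"
    proof -
      have "X - m / q * Y = (q * X - m * Y) / q" if "q \<noteq> 0" for X Y m q :: complex
        using that by (simp add: field_simps)
      note key = this [OF d(2)]
      have pS: "pfd_term s t u (Suc k) / u = (poch_coeff t (Suc k) * ?w - ?b (Suc k)) * u ^ k"
        using u0 by (simp add: pfd_term_def)
      show ?thesis
        unfolding pS key by (rule arg_cong [where f = "\<lambda>x. x / (1 + of_nat k)"])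
          (simp add: pfd_term_def algebra_simps)
    qed
    also have "\<dots> = ((t + of_nat k) * ?b k - (1 + of_nat k) * ?b (Suc k)) * u ^ k / (1 + of_nat k)"
      unfolding 1 by (simp add: algebra_simps)
    also have "(t + of_nat k) * ?b k - (1 + of_nat k) * ?b (Suc k) = s * (t - 1) * ?b k / (s + 1 + of_nat k)"
      unfolding 2 using d(1) [of k] by (simp add: field_simps)
    finally show ?thesis
      by (simp add: e_def)
  qed
  have "(\<lambda>k. pfd_term s t u (Suc k) / u - (t + of_nat k) / (1 + of_nat k) * pfd_term s t u k)
      \<longlonglongrightarrow> 0 / u - 1 * 0"
    by (intro tendsto_diff tendsto_divide tendsto_mult shifted_ratio_tendsto_1 LIMSEQ_Suc [OF f0] f0
         tendsto_const u0)
  then have e0: "e \<longlonglongrightarrow> 0"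
    by (simp add: e_eq [abs_def])
  show t1: "t = 1"
  proof (rule ccontr)
    assume "t \<noteq> 1"
    moreover have "s \<noteq> 0" using s by auto
    ultimately have e_nz: "e k \<noteq> 0" for k
      using d u0 beta_coeff_nonzero [OF s t] by (simp add: e_def)
    have "(\<lambda>k. ?b (Suc k) / ?b k * u * ((s + 1 + of_nat k) / (s + 2 + of_nat k))
          * ((1 + of_nat k) / (2 + of_nat k))) \<longlonglongrightarrow> 1 * u * 1 * 1"
      by (intro tendsto_mult tendsto_const beta_coeff_ratio_limit s t shifted_ratio_tendsto_1)
    moreover have "?b (Suc k) / ?b k * u * ((s + 1 + of_nat k) / (s + 2 + of_nat k))
          * ((1 + of_nat k) / (2 + of_nat k)) = e (Suc k) / e k" for k
    proof -
      have s2: "s + 1 + of_nat (Suc k) = s + 2 + of_nat k" "1 + of_nat (Suc k) = (2 + of_nat k :: complex)"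
        by simp_all
      show ?thesis
        unfolding e_def s2 using d [of k] \<open>t \<noteq> 1\<close> \<open>s \<noteq> 0\<close> u0 beta_coeff_nonzero [OF s t, of k]
        by (simp add: mult_ac)
    qed
    ultimately have "(\<lambda>k. e (Suc k) / e k) \<longlonglongrightarrow> u"
      by simp
    then show False
      using ratio_limit_gt_1_not_null [of e u] e_nz u e0 by blast
  qed
  show "?w = 1"
  proof (rule ccontr)
    assume w: "?w \<noteq> 1"
    have "\<not> pfd_term s t u \<longlonglongrightarrow> 0"
      using w u0 u by (intro ratio_limit_gt_1_not_null [of _ u]) (simp_all add: pfd_term_def t1 beta_coeff_1 s)
    with f0 show False by blast
  qed
qed

lemma pfd_term_one_suminf:
  assumes s: "Re s > 0" and v: "v \<noteq> 0" "v \<noteq> 1" and sm: "summable (pfd_term 1 s v)"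
  shows "suminf (pfd_term 1 s v) = 1 / v"
proof -
  define T where "T k = poch_coeff s k * v ^ k / v" for k
  have b: "beta_coeff 1 s k = poch_coeff s (Suc k)" for k
    using Gamma_fact [of "Suc k", where ?'a = complex]
    by (simp add: beta_coeff_def poch_coeff_Gamma [OF s] add_ac del: fact_Suc)
  have eq: "pfd_term 1 s v k = T k - T (Suc k)" for k
    using v by (simp add: pfd_term_def b T_def powr_minus field_simps)
  have "convergent T"
  proof -
    have "(\<lambda>n. T 0 - (\<Sum>k<n. pfd_term 1 s v k)) \<longlonglongrightarrow> T 0 - suminf (pfd_term 1 s v)"
      by (intro tendsto_intros summable_LIMSEQ sm)
    moreover have "T 0 - (\<Sum>k<n. pfd_term 1 s v k) = T n" for n
      using sum_lessThan_telescope' [of T n] by (simp add: eq)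
    ultimately show ?thesis
      by (auto simp: convergent_def)
  qed
  then obtain L where L: "T \<longlonglongrightarrow> L"
    by (auto simp: convergent_def)
  have "L = 0"
  proof (rule ccontr)
    assume "L \<noteq> 0"
    then have "(\<lambda>k. T (Suc k) / T k) \<longlonglongrightarrow> L / L"
      using L by (intro tendsto_divide LIMSEQ_Suc) auto
    moreover have "T (Suc k) / T k = (s + of_nat k) / (1 + of_nat k) * v" for k
    proof -
      have "1 + of_nat k \<noteq> (0::complex)"
        by (simp add: complex_eq_iff)
      moreover have "(1 + of_nat k) * poch_coeff s (Suc k) = (s + of_nat k) * poch_coeff s k"
        using poch_coeff_Suc [of k s] by simp
      ultimately have "poch_coeff s (Suc k) = (s + of_nat k) / (1 + of_nat k) * poch_coeff s k"
        by (simp add: field_simps)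
      then show ?thesis
        using v poch_coeff_nonzero [OF s, of k] by (simp add: T_def)
    qed
    moreover have "(\<lambda>k. (s + of_nat k) / (1 + of_nat k) * v) \<longlonglongrightarrow> 1 * v"
      by (intro tendsto_mult shifted_ratio_tendsto_1 tendsto_const)
    ultimately have "L / L = v"
      using LIMSEQ_unique by fastforce
    then show False
      using \<open>L \<noteq> 0\<close> v by simp
  qed
  then have "(\<lambda>k. T k - T (Suc k)) sums (T 0 - 0)"
    using L by (intro telescope_sums') simp
  then show ?thesis
    by (simp add: eq [abs_def] sums_iff T_def)
qed

lemma slit_domain_reflect: "1 - u \<in> slit_domain \<longleftrightarrow> u \<in> slit_domain"
  by (auto simp: slit_domain_def)

lemma pfd_outside:
  assumes s: "Re s > 0" and t: "Re t > 0" and u: "u \<in> slit_domain" "norm u > 1"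
    and sm: "summable (pfd_term s t u)" "summable (pfd_term t s (1 - u))"
  shows "suminf (pfd_term s t u) + suminf (pfd_term t s (1 - u)) = u powr (-s) * (1 - u) powr (-t)"
proof -
  have t1: "t = 1" and w: "u powr (-s) = 1"
    using pfd_term_summable_outside [OF s t u(2) sm(1)] by auto
  have nz: "1 - u \<noteq> 0" "1 - u \<noteq> 1"
    using u by (auto simp: slit_domain_def)
  have "pfd_term s t u = (\<lambda>_. 0)"
    by (simp add: fun_eq_iff pfd_term_def t1 w beta_coeff_1 s)
  then have "suminf (pfd_term s t u) = 0"
    by simp
  moreover have "suminf (pfd_term t s (1 - u)) = 1 / (1 - u)"
    using sm nz unfolding t1 by (intro pfd_term_one_suminf s)
  ultimately show ?thesis
    unfolding w using nz by (simp add: t1 powr_minus_divide)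
qed

lemma pfd_normalised:
  assumes s: "Re s > 0" and t: "Re t > 0" and u: "u \<in> slit_domain"
    and sm: "summable (pfd_term s t u)" "summable (pfd_term t s (1 - u))"
  shows "suminf (pfd_term s t u) + suminf (pfd_term t s (1 - u)) = u powr (-s) * (1 - u) powr (-t)"
proof -
  consider "norm u > 1" | "norm (1 - u) > 1" | "norm u \<le> 1" "norm (1 - u) \<le> 1"
    by linarith
  then show ?thesis
  proof cases
    case 1
    then show ?thesis using pfd_outside [OF s t u _ sm] by blast
  next
    case 2
    then show ?thesis
      using pfd_outside [OF t s _ _ sm(2)] u sm(1) slit_domain_reflect
      by (simp add: add.commute mult.commute)
  next
    case 3
    obtain P where P: "continuous_on slit_domain P"
      "\<And>z. z \<in> slit_domain \<Longrightarrow> norm z < 1 \<Longrightarrow> inc_beta s t z = P z"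
      "\<And>z. z \<in> slit_domain \<Longrightarrow> norm (1 - z) < 1 \<Longrightarrow> inc_beta t s (1 - z) = 1 - P z"
      using inc_beta_continuation [OF s t] by blast
    have cont: "isCont P u"
      using P(1) u open_slit_domain by (simp add: continuous_on_eq_continuous_at)
    then have "isCont P (1 - (1 - u))"
      by simp
    then have cont': "isCont (\<lambda>z. 1 - P (1 - z)) (1 - u)"
      by (intro continuous_intros isCont_o2 [of _ "\<lambda>z. 1 - z" P]) auto
    have "suminf (pfd_term s t u) = u powr (-s) * (1 - u) powr (-t) * (1 - P u)"
      using pfd_term_suminf [OF s t u 3(1) sm(1) cont P(2)] .
    moreover have "suminf (pfd_term t s (1 - u))
        = (1 - u) powr (-t) * (1 - (1 - u)) powr (-s) * (1 - (1 - P (1 - (1 - u))))"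
    proof (rule pfd_term_suminf [OF t s _ 3(2) sm(2) cont'])
      show "1 - u \<in> slit_domain"
        using u slit_domain_reflect by blast
      show "inc_beta t s z = 1 - P (1 - z)" if "z \<in> slit_domain" "norm z < 1" for z
        using P(3) [of "1 - z"] that slit_domain_reflect by simp
    qed
    ultimately show ?thesis
      by (simp add: algebra_simps)
  qed
qed

lemma powr_divide_Re_pos:
  assumes "Re x > 0" "Re c > 0"
  shows "(x / c) powr s = x powr s / c powr s"
proof -
  have nz: "x \<noteq> 0" "c \<noteq> 0" using assms by auto
  have "\<bar>Im (Ln x)\<bar> < pi / 2" "\<bar>Im (Ln c)\<bar> < pi / 2"
    using assms Re_Ln_pos_lt nz by blast+
  moreover have "Ln (inverse c) = - Ln c"
    using assms by (intro Ln_inverse) (auto simp: complex_nonpos_Reals_iff)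
  ultimately have "Ln (x * inverse c) = Ln x - Ln c"
    using nz by (subst Ln_times_simple) auto
  then show ?thesis
    using nz by (simp add: powr_def divide_inverse [symmetric] exp_diff [symmetric] right_diff_distrib)
qed

lemma divide_notin_nonpos_Reals:
  assumes "Re x > 0" "Re c > 0"
  shows "x / c \<notin> \<real>\<^sub>\<le>\<^sub>0"
proof
  assume "x / c \<in> \<real>\<^sub>\<le>\<^sub>0"
  then obtain r where "x / c = of_real r" "r \<le> 0"
    by (auto elim!: nonpos_Reals_cases)
  moreover have "c \<noteq> 0"
    using assms by auto
  ultimately have "x = of_real r * c"
    by (simp add: divide_eq_eq)
  then show False
    using assms \<open>r \<le> 0\<close> by (auto simp: zero_less_mult_iff)
qed

lemma pfd_term_summable:
  assumes "Re s > 0" "Re t > 0" "norm u < 1"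
  shows "summable (pfd_term s t u)"
  using pfd_term_sums [OF assms] unfolding pfd_term_def [abs_def] by (rule sums_summable)

lemma summand_eq_pfd_term:
  assumes "Re t > 0" "Re x > 0" "Re c > 0"
  shows "cbinom (t + of_nat k - 1) (of_nat k) * (1 / (x powr (s - of_nat k) * c powr (t + of_nat k)))
      - cbinom (s + t + of_nat k - 1) (s + of_nat k)
        * (1 / (x powr (- of_nat k) * c powr (s + t + of_nat k)))
    = c powr (- (s + t)) * pfd_term s t (x / c) k"
proof -
  have nz: "x \<noteq> 0" "c \<noteq> 0" using assms by auto
  have p: "z powr (of_nat k) = z ^ k" if "z \<noteq> 0" for z :: complex
    using that by (simp add: powr_nat')
  show ?thesis
    unfolding cbinom_eq_poch_coeff [OF assms(1)] cbinom_eq_beta_coeff pfd_term_def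
      powr_minus powr_diff powr_add powr_divide_Re_pos [OF assms(2,3)]
    using nz by (simp add: p field_simps)
qed

theorem proposition2p3:
  fixes s t x y :: complex and f g :: "nat \<Rightarrow> complex"
  assumes "Re s > 0" and "Re t > 0" and "Re x > 0" and "Re y > 0"
  defines "f \<equiv> (\<lambda>k. cbinom (t + of_nat k - 1) (of_nat k)
                    * (1 / (x powr (s - of_nat k) * (x + y) powr (t + of_nat k)))
                  - cbinom (s + t + of_nat k - 1) (s + of_nat k)
                    * (1 / (x powr (- of_nat k) * (x + y) powr (s + t + of_nat k))))"
  defines "g \<equiv> (\<lambda>k. cbinom (s + of_nat k - 1) (of_nat k)
                    * (1 / (y powr (t - of_nat k) * (x + y) powr (s + of_nat k)))
                  - cbinom (s + t + of_nat k - 1) (t + of_nat k)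
                    * (1 / (y powr (- of_nat k) * (x + y) powr (s + t + of_nat k))))"
  shows "(cmod x < cmod (x + y) \<longrightarrow> summable f)
       \<and> (cmod y < cmod (x + y) \<longrightarrow> summable g)
       \<and> (summable f \<and> summable g \<longrightarrow>
            1 / (x powr s * y powr t) = (\<Sum>k. f k) + (\<Sum>k. g k))"
proof -
  define c where "c = x + y"
  define C where "C = c powr (- (s + t))"
  define u where "u = x / c"
  have c: "Re c > 0" using assms by (simp add: c_def)
  then have nz: "c \<noteq> 0" "C \<noteq> 0" "x \<noteq> 0" "y \<noteq> 0"
    using assms by (auto simp: C_def)
  have v: "1 - u = y / c"
    using nz by (simp add: u_def field_simps) (simp add: c_def)
  have f: "f = (\<lambda>k. C * pfd_term s t u k)"
    using summand_eq_pfd_term [OF assms(2,3) c, of _ s] by (simp add: f_def C_def u_def c_def)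
  have g: "g = (\<lambda>k. C * pfd_term t s (1 - u) k)"
    using summand_eq_pfd_term [OF assms(1,4) c, of _ t]
    unfolding v by (simp add: g_def C_def c_def add.commute [of t s])
  have slit: "u \<in> slit_domain"
    using divide_notin_nonpos_Reals [OF assms(3) c] divide_notin_nonpos_Reals [OF assms(4) c]
    by (simp add: slit_domain_def v flip: u_def)
  have "summable f" if "norm x < norm c"
    unfolding f using that nz assms
    by (intro summable_mult pfd_term_summable) (auto simp: u_def norm_divide)
  moreover have "summable g" if "norm y < norm c"
    unfolding g v using that nz assms
    by (intro summable_mult pfd_term_summable) (auto simp: norm_divide)
  moreover have "1 / (x powr s * y powr t) = suminf f + suminf g" if "summable f" "summable g"
  proof -
    have sm: "summable (pfd_term s t u)" "summable (pfd_term t s (1 - u))"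
      using that nz by (simp_all add: f g)
    have "suminf f + suminf g = C * (suminf (pfd_term s t u) + suminf (pfd_term t s (1 - u)))"
      by (simp add: f g suminf_mult sm distrib_left)
    also have "\<dots> = C * ((x / c) powr (-s) * (y / c) powr (-t))"
      unfolding pfd_normalised [OF assms(1,2) slit sm] by (simp add: v flip: u_def)
    also have "\<dots> = 1 / (x powr s * y powr t)"
      unfolding C_def powr_divide_Re_pos [OF assms(3) c] powr_divide_Re_pos [OF assms(4) c]
        powr_minus powr_add
      using nz by (simp add: field_simps)
    finally show ?thesis ..
  qed
  ultimately show ?thesis
    by (simp add: c_def)
qed

end
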